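(* Let $G$ be a finitely generated amenable group, endowed with the word metric $d_S$ of a finite symmetric generating set $S$. Assume that $G$ has finite asymptotic dimension $d$ with corresponding control function $f:\mathbb{R}_+\to\mathbb{R}_+$. Then there exists a sequence of Følner couples $(F_n',F_n)_{n\ge 1}$ in $G$ with constant $C=d+1$ such that $\operatorname{diam}(F_n)\le f(2n)+2n$ for all $n\ge 1$. Explicitly: for every integer $n\ge 1$ there are finite non-empty subsets $F_n'\subset F_n$ of $G$ with $\#F_n\le (d+1)\,\#F_n'$, $d_S(F_n',G\setminus F_n)\ge n$, and $\operatorname{diam}(F_n)\le f(2n)+2n$.
   Context: Word metric: $l_S(g)$ is the minimal $l$ such that $g=s_1\cdots s_l$ with $s_i\in S$, and $d_S(h,g)=l_S(h^{-1}g)$ (left-invariant). Diameters and distances are taken with respect to $d_S$; $\#$ denotes cardinality. The distance from a set to the empty set is $+\infty$. Asymptotic dimension and control function: for $r>0$, a collection of subsets of a metric space is $r$-disjoint if the distance between any two distinct subsets of the collection is greater than $r$. A metric space $M$ has asymptotic dimension at most $d$ (with $d$ a non-negative integer), with control function $f:\mathbb{R}_+\to\mathbb{R}_+$, if for every $r>1$ there is a partition of $M$ into subsets, colored with $d+1$ colors, such that every subset has diameter at most $f(r)$ and, for each color, the collection of subsets of this color is $r$-disjoint. Følner couples: a sequence $(F_n',F_n)$ of pairs of finite non-empty subsets of $G$ with $F_n'\subset F_n$ is a sequence of Følner couples with constant $C<\infty$ if for all $n$ one has $\#F_n\le C\,\#F_n'$ and $d_S(F_n',G\setminus F_n)\ge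 n$. *)

theory Defs
  imports
    "HOL-Algebra.Generated_Groups"
    "HOL-Library.Disjoint_Sets"
    "HOL-Library.FuncSet"
    "HOL-Library.Extended_Real"
begin

text \<open>Outside the submonoid generated by \<open>S\<close> the word length is an unspecified number.\<close>

definition word_length :: "('a, 'b) monoid_scheme \<Rightarrow> 'a set \<Rightarrow> 'a \<Rightarrow> nat" where
  "word_length G S g =
     (LEAST l. \<exists>ws. length ws = l \<and> set ws \<subseteq> S \<and> foldr (mult G) ws \<one>\<^bsub>G\<^esub> = g)"

definition word_dist :: "('a, 'b) monoid_scheme \<Rightarrow> 'a set \<Rightarrow> 'a \<Rightarrow> 'a \<Rightarrow> real" where
  "word_dist G S h g = real (word_length G S (inv\<^bsub>G\<^esub> h \<otimes>\<^bsub>G\<^esub> g))"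

text \<open>
  Distances between sets and diameters are extended reals, so that the distance to the empty set
  is \<open>\<infinity>\<close> and unbounded sets have diameter \<open>\<infinity>\<close>. The diameter of the empty set is \<open>-\<infinity>\<close> here;
  below, diameters are only taken of nonempty sets.
\<close>

definition set_dist :: "('a \<Rightarrow> 'a \<Rightarrow> real) \<Rightarrow> 'a set \<Rightarrow> 'a set \<Rightarrow> ereal" where
  "set_dist \<delta> A B = (INF a\<in>A. INF b\<in>B. ereal (\<delta> a b))"

definition set_diam :: "('a \<Rightarrow> 'a \<Rightarrow> real) \<Rightarrow> 'a set \<Rightarrow> ereal" where
  "set_diam \<delta> A = (SUP a\<in>A. SUP b\<in>A. ereal (\<delta> a b))"

definition r_disjoint :: "('a \<Rightarrow> 'a \<Rightarrow> real) \<Rightarrow> real \<Rightarrow> 'a set set \<Rightarrow> bool" where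
  "r_disjoint \<delta> r \<A> \<longleftrightarrow> (\<forall>A\<in>\<A>. \<forall>B\<in>\<A>. A \<noteq> B \<longrightarrow> ereal r < set_dist \<delta> A B)"

text \<open>
  The colors are \<open>0, \<dots>, d\<close>. Values of \<open>f\<close> outside the positive reals are irrelevant.
\<close>

definition asdim_at_most_with_control ::
    "'a set \<Rightarrow> ('a \<Rightarrow> 'a \<Rightarrow> real) \<Rightarrow> nat \<Rightarrow> (real \<Rightarrow> real) \<Rightarrow> bool" where
  "asdim_at_most_with_control M \<delta> d f \<longleftrightarrow>
     f \<in> {0<..} \<rightarrow> {0..} \<and>
     (\<forall>r>1. \<exists>P color. partition_on M P \<and> color \<in> P \<rightarrow> {0..d} \<and>
        (\<forall>A\<in>P. set_diam \<delta> A \<le> ereal (f r)) \<and>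
        (\<forall>i\<in>{0..d}. r_disjoint \<delta> r {A \<in> P. color A = i}))"

text \<open>
  Amenability in the sense of von Neumann: a left-invariant finitely additive probability measure
  defined on all subsets of the group.
\<close>

definition amenable :: "('a, 'b) monoid_scheme \<Rightarrow> bool" where
  "amenable G \<longleftrightarrow>
     (\<exists>\<mu> :: 'a set \<Rightarrow> real.
        (\<forall>A. A \<subseteq> carrier G \<longrightarrow> 0 \<le> \<mu> A) \<and>
        \<mu> (carrier G) = 1 \<and>
        (\<forall>A B. A \<subseteq> carrier G \<longrightarrow> B \<subseteq> carrier G \<longrightarrow> A \<inter> B = {} \<longrightarrow> \<mu> (A \<union> B) = \<mu> A + \<mu> B) \<and>
        (\<forall>g\<in>carrier G. \<forall>A. A \<subseteq> carrier G \<longrightarrow> \<mu> (g <#\<^bsub>G\<^esub> A) = \<mu> A))"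

definition folner_couples ::
    "('a, 'b) monoid_scheme \<Rightarrow> 'a set \<Rightarrow> real \<Rightarrow> (nat \<Rightarrow> 'a set) \<Rightarrow> (nat \<Rightarrow> 'a set) \<Rightarrow> bool" where
  "folner_couples G S C F' F \<longleftrightarrow>
     (\<forall>n\<ge>1. finite (F' n) \<and> finite (F n) \<and> F' n \<noteq> {} \<and> F n \<noteq> {} \<and>
        F' n \<subseteq> F n \<and> F n \<subseteq> carrier G \<and>
        real (card (F n)) \<le> C * real (card (F' n)) \<and>
        ereal (real n) \<le> set_dist (word_dist G S) (F' n) (carrier G - F n))"

end

theory Submission imports Defs begin

text \<open>
  Fix \<open>n\<close>, take a coloured partition for \<open>r = 2n\<close>, and let \<open>N A\<close> be the closed \<open>n\<close>-neighbourhood of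
  a piece \<open>A\<close>; pieces of equal colour have disjoint neighbourhoods. If no couple \<open>(A, N A)\<close> worked,
  then \<open>d + 1\<close> disjoint copies of \<open>A\<close> plus one extra point would inject into \<open>N A\<close> for every piece.
  An invariant mean is preserved by injections of bounded displacement, so for each colour \<open>i\<close> the
  mean of the union \<open>U i\<close> of the pieces and that of a transversal \<open>T i\<close> of them satisfy
  \<open>(d + 1) \<nu> (U i) + \<nu> (T i) \<le> 1\<close>. Summing over the \<open>d + 1\<close> colours gives
  \<open>(d + 1) + \<nu> T \<le> d + 1\<close> for a transversal \<open>T\<close> of the whole partition. But finitely many
  translates of \<open>T\<close> cover the group, as the pieces have bounded diameter, so \<open>\<nu> T > 0\<close>.
\<close>

section \<open>Word metrics\<close>

locale word_metric = group G for G (structure) +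
  fixes S :: "'a set"
  assumes S_carrier: "S \<subseteq> carrier G"
    and S_inv: "s \<in> S \<Longrightarrow> inv s \<in> S"
    and generate_S: "generate G S = carrier G"
begin

lemma foldr_mult_closed: "set ws \<subseteq> S \<Longrightarrow> foldr (\<otimes>) ws \<one> \<in> carrier G"
  using S_carrier by (induction ws) auto

lemma foldr_mult_append:
  assumes "set us \<subseteq> S" "set vs \<subseteq> S"
  shows "foldr (\<otimes>) (us @ vs) \<one> = foldr (\<otimes>) us \<one> \<otimes> foldr (\<otimes>) vs \<one>"
  using assms(1)
proof (induction us)
  case Nil
  then show ?case using foldr_mult_closed[OF assms(2)] by simp
next
  case (Cons u us)
  then show ?case
    using foldr_mult_closed[OF assms(2)] foldr_mult_closed[of us] S_carrier
    by (auto simp del: foldr_append simp: m_assoc subset_iff)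
qed

text \<open>Reverse the word and invert its letters; symmetry of \<open>S\<close> keeps the new
  letters in \<open>S\<close>.\<close>

lemma ex_inverse_word:
  assumes "set ws \<subseteq> S"
  shows "\<exists>vs. length vs = length ws \<and> set vs \<subseteq> S \<and> foldr (\<otimes>) vs \<one> = inv (foldr (\<otimes>) ws \<one>)"
  using assms
proof (induction ws)
  case Nil
  then show ?case by simp
next
  case (Cons w ws)
  then obtain vs where vs: "length vs = length ws" "set vs \<subseteq> S"
      "foldr (\<otimes>) vs \<one> = inv (foldr (\<otimes>) ws \<one>)"
    by auto
  have w: "w \<in> S" "inv w \<in> S" "w \<in> carrier G"
    using Cons.prems S_inv S_carrier by auto
  have "foldr (\<otimes>) (vs @ [inv w]) \<one> = inv (foldr (\<otimes>) (w # ws) \<one>)"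
    using foldr_mult_append[of vs "[inv w]"] vs w Cons.prems foldr_mult_closed[of ws]
    by (simp add: inv_mult_group)
  then show ?case
    using vs w by (intro exI[of _ "vs @ [inv w]"]) auto
qed

text \<open>Inverses of generators are themselves letters, so the subgroup generated by the
  symmetric set \<open>S\<close> consists of products of words. Hence the \<open>LEAST\<close> in
  \<open>word_length\<close> is attained on the whole carrier.\<close>

lemma ex_word:
  assumes "g \<in> carrier G"
  shows "\<exists>ws. set ws \<subseteq> S \<and> foldr (\<otimes>) ws \<one> = g"
proof -
  have "g \<in> generate G S" using assms generate_S by simp
  then show ?thesis
  proof (induction rule: generate.induct)
    case one
    show ?case by (intro exI[of _ "[]"]) simp
  next
    case (incl h)
    then show ?case using S_carrier by (intro exI[of _ "[h]"]) auto
  next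
    case (inv h)
    then show ?case using S_carrier S_inv by (intro exI[of _ "[inv h]"]) auto
  next
    case (eng h k)
    then obtain us vs where "set us \<subseteq> S" "foldr (\<otimes>) us \<one> = h" "set vs \<subseteq> S" "foldr (\<otimes>) vs \<one> = k"
      by auto
    then show ?case
      using foldr_mult_append[of us vs] by (intro exI[of _ "us @ vs"]) auto
  qed
qed

lemma word_length_le:
  assumes "set ws \<subseteq> S"
  shows "word_length G S (foldr (\<otimes>) ws \<one>) \<le> length ws"
  unfolding word_length_def using assms by (intro Least_le) auto

lemma word_length_attained:
  assumes "g \<in> carrier G"
  obtains ws where "length ws = word_length G S g" "set ws \<subseteq> S" "foldr (\<otimes>) ws \<one> = g"
proof -
  have "\<exists>l ws. length ws = l \<and> set ws \<subseteq> S \<and> foldr (\<otimes>) ws \<one> = g"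
    using ex_word[OF assms] by blast
  from LeastI_ex[OF this] show ?thesis
    using that unfolding word_length_def by blast
qed

lemma word_length_mult:
  assumes "g \<in> carrier G" "h \<in> carrier G"
  shows "word_length G S (g \<otimes> h) \<le> word_length G S g + word_length G S h"
proof -
  obtain us where us: "length us = word_length G S g" "set us \<subseteq> S" "foldr (\<otimes>) us \<one> = g"
    using word_length_attained[OF assms(1)] .
  obtain vs where vs: "length vs = word_length G S h" "set vs \<subseteq> S" "foldr (\<otimes>) vs \<one> = h"
    using word_length_attained[OF assms(2)] .
  show ?thesis
    using word_length_le[of "us @ vs"] foldr_mult_append[of us vs] us vs by auto
qed

lemma word_length_inv_le:
  assumes "g \<in> carrier G"
  shows "word_length G S (inv g) \<le> word_length G S g"
proof -
  obtain ws where ws: "length ws = word_length G S g" "set ws \<subseteq> S" "foldr (\<otimes>) ws \<one> = g"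
    using word_length_attained[OF assms] .
  then obtain vs where "length vs = length ws" "set vs \<subseteq> S" "foldr (\<otimes>) vs \<one> = inv g"
    using ex_inverse_word by blast
  then show ?thesis
    using word_length_le[of vs] ws by simp
qed

text \<open>There are only finitely many words of bounded length over a finite alphabet. Finiteness
  of balls is what lets a finitely additive mean handle maps of bounded displacement.\<close>

lemma finite_word_ball:
  assumes "finite S"
  shows "finite {g \<in> carrier G. word_length G S g \<le> k}"
proof (rule finite_subset)
  show "{g \<in> carrier G. word_length G S g \<le> k}
      \<subseteq> (\<lambda>ws. foldr (\<otimes>) ws \<one>) ` {ws. set ws \<subseteq> S \<and> length ws \<le> k}"
  proof
    fix g assume g: "g \<in> {g \<in> carrier G. word_length G S g \<le> k}"
    then obtain ws where "length ws = word_length G S g" "set ws \<subseteq> S" "foldr (\<otimes>) ws \<one> = g"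
      using word_length_attained by blast
    then show "g \<in> (\<lambda>ws. foldr (\<otimes>) ws \<one>) ` {ws. set ws \<subseteq> S \<and> length ws \<le> k}"
      using g by (intro image_eqI[of _ _ ws]) auto
  qed
  show "finite ((\<lambda>ws. foldr (\<otimes>) ws \<one>) ` {ws. set ws \<subseteq> S \<and> length ws \<le> k})"
    by (intro finite_imageI finite_lists_length_le assms)
qed

lemma word_length_one: "word_length G S \<one> = 0"
  using word_length_le[of "[]"] by simp

lemma word_dist_self: "x \<in> carrier G \<Longrightarrow> word_dist G S x x = 0"
  by (simp add: word_dist_def word_length_one)

lemma word_dist_triangle:
  assumes "x \<in> carrier G" "y \<in> carrier G" "z \<in> carrier G"
  shows "word_dist G S x z \<le> word_dist G S x y + word_dist G S y z"
proof -
  have "y \<otimes> (inv y \<otimes> z) = z"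
    using assms by (simp flip: m_assoc)
  then have "(inv x \<otimes> y) \<otimes> (inv y \<otimes> z) = inv x \<otimes> z"
    using assms by (simp add: m_assoc)
  then show ?thesis
    using word_length_mult[of "inv x \<otimes> y" "inv y \<otimes> z"] assms
    unfolding word_dist_def by (simp flip: of_nat_add)
qed

lemma word_dist_commute:
  assumes "x \<in> carrier G" "y \<in> carrier G"
  shows "word_dist G S x y = word_dist G S y x"
proof -
  have "inv (inv x \<otimes> y) = inv y \<otimes> x" "inv (inv y \<otimes> x) = inv x \<otimes> y"
    using assms by (simp_all add: inv_mult_group)
  then show ?thesis
    using word_length_inv_le[of "inv x \<otimes> y"] word_length_inv_le[of "inv y \<otimes> x"] assms
    unfolding word_dist_def by simp
qed

end

section \<open>Right-invariant means\<close>

text \<open>The word metric is left-invariant, so moving a point a bounded distance means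
  multiplying it on the right by an element of a finite ball. Right invariance is therefore the
  useful side, although \<open>amenable\<close> supplies a left-invariant mean.\<close>

locale right_invariant_mean = group G for G (structure) +
  fixes \<nu> :: "'a set \<Rightarrow> real"
  assumes mean_nonneg: "A \<subseteq> carrier G \<Longrightarrow> 0 \<le> \<nu> A"
    and mean_carrier: "\<nu> (carrier G) = 1"
    and mean_Un: "A \<subseteq> carrier G \<Longrightarrow> B \<subseteq> carrier G \<Longrightarrow> A \<inter> B = {} \<Longrightarrow> \<nu> (A \<union> B) = \<nu> A + \<nu> B"
    and mean_r_coset: "g \<in> carrier G \<Longrightarrow> A \<subseteq> carrier G \<Longrightarrow> \<nu> (A #> g) = \<nu> A"

text \<open>Inversion exchanges left and right translations, so pulling a left-invariant mean back
  along it gives a right-invariant one.\<close>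

lemma (in group) amenable_imp_right_invariant_mean:
  assumes "amenable G"
  obtains \<nu> where "right_invariant_mean G \<nu>"
proof -
  obtain \<mu> :: "'a set \<Rightarrow> real" where "\<forall>A. A \<subseteq> carrier G \<longrightarrow> 0 \<le> \<mu> A" "\<mu> (carrier G) = 1"
      "\<forall>A B. A \<subseteq> carrier G \<longrightarrow> B \<subseteq> carrier G \<longrightarrow> A \<inter> B = {} \<longrightarrow> \<mu> (A \<union> B) = \<mu> A + \<mu> B"
      "\<forall>g\<in>carrier G. \<forall>A. A \<subseteq> carrier G \<longrightarrow> \<mu> (g <# A) = \<mu> A"
    using assms unfolding amenable_def by (elim exE conjE)
  note \<mu> = this[rule_format]
  have "right_invariant_mean G (\<lambda>A. \<mu> (m_inv G ` A))"
  proof unfold_locales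
    fix A assume "A \<subseteq> carrier G"
    then show "0 \<le> \<mu> (m_inv G ` A)" by (intro \<mu>) auto
  next
    have "m_inv G ` carrier G = carrier G"
      by (force intro: image_eqI[of _ "m_inv G" "inv x" for x])
    then show "\<mu> (m_inv G ` carrier G) = 1" using \<mu> by simp
  next
    fix A B assume AB: "A \<subseteq> carrier G" "B \<subseteq> carrier G" "A \<inter> B = {}"
    then have "m_inv G ` A \<inter> m_inv G ` B = {}"
      using inj_on_image_Int[OF inv_inj, of A B] by simp
    then show "\<mu> (m_inv G ` (A \<union> B)) = \<mu> (m_inv G ` A) + \<mu> (m_inv G ` B)"
      unfolding image_Un using AB by (intro \<mu>(3)) auto
  next
    fix g A assume gA: "g \<in> carrier G" "A \<subseteq> carrier G"
    have "m_inv G ` (A #> g) = (\<lambda>a. inv (a \<otimes> g)) ` A"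
      by (auto simp: r_coset_def)
    also have "\<dots> = (\<lambda>a. inv g \<otimes> inv a) ` A"
      using gA by (intro image_cong) (auto simp: inv_mult_group)
    also have "\<dots> = inv g <# (m_inv G ` A)"
      by (auto simp: l_coset_def)
    finally have "m_inv G ` (A #> g) = inv g <# (m_inv G ` A)" .
    then show "\<mu> (m_inv G ` (A #> g)) = \<mu> (m_inv G ` A)"
      using gA \<mu>(4)[of "inv g" "m_inv G ` A"] by auto
  qed
  then show ?thesis by (rule that)
qed

context right_invariant_mean
begin

lemma mean_empty: "\<nu> {} = 0"
  using mean_Un[of "{}" "{}"] by simp

lemma mean_mono:
  assumes "A \<subseteq> B" "B \<subseteq> carrier G"
  shows "\<nu> A \<le> \<nu> B"
proof -
  have "A \<union> (B - A) = B" using assms by blast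
  then show ?thesis
    using mean_Un[of A "B - A"] mean_nonneg[of "B - A"] assms by fastforce
qed

lemma mean_UN_disjoint:
  assumes "finite I" "\<And>i. i \<in> I \<Longrightarrow> A i \<subseteq> carrier G" "disjoint_family_on A I"
  shows "\<nu> (\<Union>i\<in>I. A i) = (\<Sum>i\<in>I. \<nu> (A i))"
  using assms
proof (induction I rule: finite_induct)
  case empty
  then show ?case by (simp add: mean_empty)
next
  case (insert i I)
  have "A i \<inter> (\<Union>j\<in>I. A j) = {}"
    using insert.hyps insert.prems(2) by (fastforce simp: disjoint_family_on_def)
  moreover have "disjoint_family_on A I"
    using insert.prems(2) by (auto simp: disjoint_family_on_def)
  ultimately show ?case
    using insert mean_Un[of "A i" "\<Union>j\<in>I. A j"] by auto
qed

lemma mean_UN_le: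
  assumes "finite I" "\<And>i. i \<in> I \<Longrightarrow> A i \<subseteq> carrier G"
  shows "\<nu> (\<Union>i\<in>I. A i) \<le> (\<Sum>i\<in>I. \<nu> (A i))"
  using assms
proof (induction I rule: finite_induct)
  case empty
  then show ?case by (simp add: mean_empty)
next
  case (insert i I)
  let ?U = "\<Union>j\<in>I. A j"
  have U: "?U \<subseteq> carrier G" "A i \<subseteq> carrier G" using insert by auto
  have "\<nu> (A i \<union> ?U) = \<nu> (A i) + \<nu> (?U - A i)"
    using mean_Un[of "A i" "?U - A i"] U by (simp add: subset_trans[OF Diff_subset])
  also have "\<nu> (?U - A i) \<le> \<nu> ?U"
    using U by (intro mean_mono) auto
  finally show ?case using insert by auto
qed

text \<open>Sort the points of \<open>X\<close> by their displacement \<open>b\<close>. This gives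
  finitely many classes \<open>Y b\<close>, and on each of them the map is right translation by
  \<open>b\<close>.\<close>

lemma mean_image_bounded_displacement:
  assumes "finite B" "B \<subseteq> carrier G" "X \<subseteq> carrier G" "inj_on \<phi> X"
    and \<phi>: "\<And>x. x \<in> X \<Longrightarrow> \<phi> x \<in> carrier G \<and> inv x \<otimes> \<phi> x \<in> B"
  shows "\<nu> (\<phi> ` X) = \<nu> X"
proof -
  define Y where "Y b = {x \<in> X. inv x \<otimes> \<phi> x = b}" for b
  have Y: "Y b \<subseteq> X" for b by (auto simp: Y_def)
  have eq: "\<phi> ` Y b = Y b #> b" if "b \<in> B" for b
  proof -
    have "\<phi> x = x \<otimes> b" if "x \<in> Y b" for x
    proof -
      have "x \<in> carrier G" "\<phi> x \<in> carrier G" "inv x \<otimes> \<phi> x = b"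
        using that assms(3) \<phi> by (auto simp: Y_def)
      then show ?thesis by (auto simp flip: m_assoc)
    qed
    then show ?thesis by (auto simp: r_coset_def)
  qed
  have X: "X = (\<Union>b\<in>B. Y b)" using \<phi> by (auto simp: Y_def)
  have dY: "disjoint_family_on Y B" by (auto simp: disjoint_family_on_def Y_def)
  \<comment> \<open>Injectivity enters here: it keeps the translated classes disjoint, so that
    finite additivity applies to the image as well.\<close>
  have "disjoint_family_on (\<lambda>b. \<phi> ` Y b) B"
    using dY unfolding disjoint_family_on_def
    by (simp add: inj_on_image_Int[OF assms(4) Y Y, symmetric])
  then have "\<nu> (\<Union>b\<in>B. \<phi> ` Y b) = (\<Sum>b\<in>B. \<nu> (\<phi> ` Y b))"
    using \<phi> Y by (intro mean_UN_disjoint assms(1)) auto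
  also have "\<dots> = (\<Sum>b\<in>B. \<nu> (Y b))"
    using Y assms by (intro sum.cong refl) (auto simp: eq intro!: mean_r_coset)
  also have "\<dots> = \<nu> (\<Union>b\<in>B. Y b)"
    using Y assms by (intro mean_UN_disjoint[symmetric] assms(1) dY) auto
  finally show ?thesis by (simp add: X[symmetric] flip: image_UN)
qed

text \<open>The counting core, free of the metric: \<open>N A\<close> stands for a neighbourhood of
  the piece \<open>A\<close>, and the finite set \<open>B\<close> for a ball bounding all
  displacements from \<open>A\<close> into \<open>N A\<close>.\<close>

lemma ex_small_neighbourhood:
  assumes P: "partition_on (carrier G) P" and color: "color \<in> P \<rightarrow> {0..d}"
    and B: "finite B" "B \<subseteq> carrier G"
    and fin: "\<And>A. A \<in> P \<Longrightarrow> finite A" "\<And>A. A \<in> P \<Longrightarrow> finite (N A)"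
    and N: "\<And>A. A \<in> P \<Longrightarrow> A \<subseteq> N A" "\<And>A. A \<in> P \<Longrightarrow> N A \<subseteq> carrier G"
    and displacement: "\<And>A a x. A \<in> P \<Longrightarrow> a \<in> A \<Longrightarrow> x \<in> N A \<Longrightarrow> inv a \<otimes> x \<in> B"
    and disj: "\<And>A A'. A \<in> P \<Longrightarrow> A' \<in> P \<Longrightarrow> A \<noteq> A' \<Longrightarrow> color A = color A' \<Longrightarrow> N A \<inter> N A' = {}"
  shows "\<exists>A\<in>P. card (N A) \<le> (d + 1) * card A"
proof (rule ccontr)
  assume "\<not> ?thesis"
  \<comment> \<open>Integrality turns strict inequality into one spare point per neighbourhood.
    Without it the colour inequalities would only sum to \<open>d + 1 \<le> d + 1\<close>.\<close>
  then have large: "(d + 1) * card A + 1 \<le> card (N A)" if "A \<in> P" for A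
    using that by (metis Suc_eq_plus1 Suc_leI not_le)
  have ne: "A \<noteq> {}" if "A \<in> P" for A
    using that P by (auto simp: partition_on_def)
  have cover: "\<Union>P = carrier G"
    using P by (auto simp: partition_on_def)
  have unique: "A = A'" if "A \<in> P" "A' \<in> P" "x \<in> A" "x \<in> A'" for A A' x
    using that P by (auto simp: partition_on_def disjoint_def)
  define rep where "rep A = (SOME a. a \<in> A)" for A :: "'a set"
  have rep: "rep A \<in> A" if "A \<in> P" for A
    unfolding rep_def using ne[OF that] by (auto intro: someI_ex)
  \<comment> \<open>The labels \<open>0\<close> to \<open>d\<close> mark the copies of
    \<open>A\<close>; the fresh label \<open>d + 1\<close> keeps the spare point, placed over the
    representative, apart from them.\<close>
  define D where "D A = A \<times> {0..d} \<union> {(rep A, d + 1)}" for A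
  have "\<exists>\<phi>. \<phi> ` D A \<subseteq> N A \<and> inj_on \<phi> (D A)" if "A \<in> P" for A
  proof -
    have "card (D A) = (d + 1) * card A + 1"
      using fin(1)[OF that] unfolding D_def by (subst card_Un_disjoint) (auto simp: card_cartesian_product)
    moreover have "finite (D A)" using fin(1)[OF that] by (simp add: D_def)
    ultimately show ?thesis
      using card_le_inj[of "D A" "N A"] large[OF that] fin(2)[OF that] by auto
  qed
  then obtain \<phi> where \<phi>: "\<And>A. A \<in> P \<Longrightarrow> \<phi> A ` D A \<subseteq> N A" "\<And>A. A \<in> P \<Longrightarrow> inj_on (\<phi> A) (D A)"
    by metis
  define piece where "piece x = (THE A. A \<in> P \<and> x \<in> A)" for x
  have piece: "piece x = A" if "A \<in> P" "x \<in> A" for A x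
    unfolding piece_def
  proof (rule the_equality)
    show "A' = A" if "A' \<in> P \<and> x \<in> A'" for A'
      by (rule unique[of A' A x]) (use that \<open>A \<in> P\<close> \<open>x \<in> A\<close> in simp_all)
  qed (use that in simp)
  define \<psi> where "\<psi> j x = \<phi> (piece x) (x, j)" for j x
  \<comment> \<open>Layer \<open>j\<close> over the pieces of colour \<open>i\<close>: all of
    \<open>U i\<close> when \<open>j \<le> d\<close>, and the transversal \<open>T i\<close> when
    \<open>j = d + 1\<close>.\<close>
  define X where "X i j = {x. \<exists>A\<in>P. color A = i \<and> (x, j) \<in> D A}" for i j
  have XE: "piece x \<in> P \<and> color (piece x) = i \<and> x \<in> piece x \<and> (x, j) \<in> D (piece x) \<and> \<psi> j x \<in> N (piece x)"
    if "x \<in> X i j" for x i j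
  proof -
    from that obtain A where A: "A \<in> P" "color A = i" "(x, j) \<in> D A" by (auto simp: X_def)
    then have "x \<in> A" using rep by (auto simp: D_def)
    then have "piece x = A" using A piece by blast
    then show ?thesis using A \<open>x \<in> A\<close> \<phi>(1) unfolding \<psi>_def by blast
  qed
  have X_carrier: "X i j \<subseteq> carrier G" for i j
    using XE cover by blast
  \<comment> \<open>Within one colour, equal images force the same piece because the neighbourhoods
    are disjoint; then injectivity of \<open>\<phi>\<close> on that piece recovers point and label.
    This yields both injectivity of each layer map and disjointness of the images of different
    layers.\<close>
  have \<psi>_eq: "x = y \<and> j = k" if "x \<in> X i j" "y \<in> X i k" "\<psi> j x = \<psi> k y" for i j k x y
  proof -
    have "piece x = piece y"
      using XE[OF that(1)] XE[OF that(2)] that(3) disj by (metis IntI empty_iff)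
    then show ?thesis
      using XE[OF that(1)] XE[OF that(2)] that(3) \<phi>(2)[of "piece x"]
      unfolding \<psi>_def inj_on_def by (metis Pair_inject)
  qed
  have mean_\<psi>: "\<nu> (\<psi> j ` X i j) = \<nu> (X i j)" for i j
  proof (rule mean_image_bounded_displacement[OF B X_carrier])
    show "inj_on (\<psi> j) (X i j)" using \<psi>_eq by (auto simp: inj_on_def)
    show "\<psi> j x \<in> carrier G \<and> inv x \<otimes> \<psi> j x \<in> B" if "x \<in> X i j" for x
      using XE[OF that] N(2) displacement by blast
  qed
  define U where "U i = \<Union>{A \<in> P. color A = i}" for i
  define T where "T i = rep ` {A \<in> P. color A = i}" for i
  have X_le: "X i j = U i" if "j \<le> d" for i j
    using that by (auto simp: X_def U_def D_def)
  have X_Suc: "X i (d + 1) = T i" for i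
    by (auto simp: X_def T_def D_def)
  \<comment> \<open>The \<open>d + 2\<close> layers of one colour keep their means and have disjoint
    images in a group of total mean 1.\<close>
  have colour_le: "real (d + 1) * \<nu> (U i) + \<nu> (T i) \<le> 1" for i
  proof -
    have "real (d + 1) * \<nu> (U i) + \<nu> (T i) = (\<Sum>j\<le>d + 1. \<nu> (X i j))"
      using X_Suc by (simp add: X_le)
    also have "\<dots> = (\<Sum>j\<le>d + 1. \<nu> (\<psi> j ` X i j))"
      by (simp only: mean_\<psi>)
    also have "\<dots> = \<nu> (\<Union>j\<le>d + 1. \<psi> j ` X i j)"
    proof (rule mean_UN_disjoint[symmetric])
      show "\<psi> j ` X i j \<subseteq> carrier G" for j using XE N(2) by blast
      show "disjoint_family_on (\<lambda>j. \<psi> j ` X i j) {..d + 1}"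
        using \<psi>_eq unfolding disjoint_family_on_def by blast
    qed simp
    also have "\<dots> \<le> \<nu> (carrier G)"
      using XE N(2) by (intro mean_mono) blast+
    finally show ?thesis using mean_carrier by simp
  qed
  have color_le: "color A \<le> d" if "A \<in> P" for A using color that by auto
  have "1 = \<nu> (\<Union>i\<le>d. U i)"
  proof -
    have "(\<Union>i\<le>d. U i) = \<Union>P" unfolding U_def using color_le by blast
    then show ?thesis using mean_carrier cover by simp
  qed
  also have "\<dots> = (\<Sum>i\<le>d. \<nu> (U i))"
  proof (rule mean_UN_disjoint)
    show "disjoint_family_on U {..d}"
      using unique unfolding disjoint_family_on_def U_def by blast
  qed (use cover in \<open>auto simp: U_def\<close>)
  finally have sum_U: "(\<Sum>i\<le>d. \<nu> (U i)) = 1" by simp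
  have rep_P: "rep ` P = (\<Union>i\<le>d. T i)"
    unfolding T_def using color_le by blast
  have T_carrier: "T i \<subseteq> carrier G" for i
    using rep cover by (auto simp: T_def)
  have "\<nu> (\<Union>i\<le>d. T i) \<le> (\<Sum>i\<le>d. \<nu> (T i))"
    using T_carrier by (intro mean_UN_le) auto
  moreover have "(\<Sum>i\<le>d. real (d + 1) * \<nu> (U i) + \<nu> (T i)) \<le> (\<Sum>i\<le>d. 1)"
    by (intro sum_mono colour_le)
  \<comment> \<open>The sets \<open>U i\<close> have total mean 1, so they use up the whole bound
    \<open>d + 1\<close> and leave nothing for the transversals.\<close>
  ultimately have rep_le: "\<nu> (rep ` P) \<le> 0"
    using sum_U by (simp add: sum.distrib rep_P flip: sum_distrib_left)
  \<comment> \<open>Since \<open>A\<close> lies inside \<open>N A\<close>, each point of a piece is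
    its representative times an element of \<open>B\<close>. Finitely many translates of a null set
    thus cover a group of mean 1.\<close>
  have rep_cover: "carrier G \<subseteq> (\<Union>b\<in>B. rep ` P #> b)"
  proof
    fix x assume x: "x \<in> carrier G"
    then obtain A where A: "A \<in> P" "x \<in> A" using cover by blast
    let ?b = "inv (rep A) \<otimes> x"
    have "?b \<in> B" using displacement rep A N(1) by blast
    moreover have "rep A \<in> carrier G" using rep[OF A(1)] A cover by blast
    then have "rep A \<otimes> ?b = x" using x by (simp flip: m_assoc)
    ultimately show "x \<in> (\<Union>b\<in>B. rep ` P #> b)"
      using A unfolding r_coset_def by force
  qed
  have R: "rep ` P \<subseteq> carrier G" using T_carrier by (auto simp: rep_P)
  have "\<nu> (carrier G) \<le> \<nu> (\<Union>b\<in>B. rep ` P #> b)"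
    using B R r_coset_subset_G by (intro mean_mono rep_cover) blast
  also have "\<dots> \<le> (\<Sum>b\<in>B. \<nu> (rep ` P #> b))"
    using B R by (intro mean_UN_le r_coset_subset_G) auto
  also have "\<dots> = real (card B) * \<nu> (rep ` P)"
    using B R by (simp add: mean_r_coset subset_iff)
  also have "\<dots> \<le> 0"
    using rep_le by (simp add: mult_nonneg_nonpos)
  finally show False using mean_carrier by simp
qed

end

section \<open>Controlled asymptotic dimension\<close>

lemma set_diamD: "set_diam \<delta> A \<le> ereal c \<Longrightarrow> a \<in> A \<Longrightarrow> b \<in> A \<Longrightarrow> \<delta> a b \<le> c"
  by (auto simp: set_diam_def SUP_le_iff)

lemma set_distD: "ereal r < set_dist \<delta> A B \<Longrightarrow> a \<in> A \<Longrightarrow> b \<in> B \<Longrightarrow> r < \<delta> a b"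
proof -
  assume "ereal r < set_dist \<delta> A B" "a \<in> A" "b \<in> B"
  moreover from this have "set_dist \<delta> A B \<le> ereal (\<delta> a b)"
    unfolding set_dist_def by (intro INF_lower2[of a] INF_lower)
  ultimately show "r < \<delta> a b"
    using less_le_trans by fastforce
qed

text \<open>The couple consists of a piece of the partition and its closed
  \<open>n\<close>-neighbourhood, for a piece selected by
  \<open>ex_small_neighbourhood\<close>.\<close>

lemma (in word_metric) ex_folner_couple:
  fixes f :: "real \<Rightarrow> real"
  assumes "finite S" "amenable G"
    and asdim: "asdim_at_most_with_control (carrier G) (word_dist G S) d f"
    and "n \<ge> 1"
  shows "\<exists>A E. finite A \<and> finite E \<and> A \<noteq> {} \<and> E \<noteq> {} \<and> A \<subseteq> E \<and> E \<subseteq> carrier G \<and>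
    real (card E) \<le> (real d + 1) * real (card A) \<and>
    ereal (real n) \<le> set_dist (word_dist G S) A (carrier G - E) \<and>
    set_diam (word_dist G S) E \<le> ereal (f (2 * real n) + 2 * real n)"
proof -
  \<comment> \<open>Pieces whose closed \<open>n\<close>-neighbourhoods meet have points at distance
    at most \<open>2 * n\<close>; the strict separation at scale \<open>2 * n\<close> rules this out
    for equal colours.\<close>
  let ?\<delta> = "word_dist G S" and ?r = "2 * real n"
  obtain \<nu> where "right_invariant_mean G \<nu>"
    using amenable_imp_right_invariant_mean[OF assms(2)] .
  then interpret right_invariant_mean G \<nu> .
  have "?r > 1" using \<open>n \<ge> 1\<close> by simp
  from asdim[unfolded asdim_at_most_with_control_def, THEN conjunct2, rule_format, OF this]
  obtain P color where P: "partition_on (carrier G) P" and color: "color \<in> P \<rightarrow> {0..d}"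
    and diam: "\<And>A. A \<in> P \<Longrightarrow> set_diam ?\<delta> A \<le> ereal (f ?r)"
    and r_disj: "\<And>i. i \<in> {0..d} \<Longrightarrow> r_disjoint ?\<delta> ?r {A \<in> P. color A = i}"
    by blast
  have carrier: "x \<in> carrier G" if "A \<in> P" "x \<in> A" for A x
    using P that by (auto simp: partition_on_def)
  define N where "N A = {x \<in> carrier G. \<exists>a\<in>A. ?\<delta> a x \<le> n}" for A
  \<comment> \<open>From a point of a piece to a point of its neighbourhood: cross the piece, at
    cost \<open>f ?r\<close>, then leave it, at cost \<open>n\<close>. Lengths are natural numbers,
    so rounding down loses nothing.\<close>
  define B where "B = {g \<in> carrier G. word_length G S g \<le> nat \<lfloor>f ?r + n\<rfloor>}"
  have displacement: "inv a \<otimes> x \<in> B" if "A \<in> P" "a \<in> A" "x \<in> N A" for A a x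
  proof -
    obtain b where b: "b \<in> A" "?\<delta> b x \<le> n" "x \<in> carrier G"
      using \<open>x \<in> N A\<close> by (auto simp: N_def)
    have "?\<delta> a x \<le> ?\<delta> a b + ?\<delta> b x"
      using that b carrier by (intro word_dist_triangle) auto
    also have "\<dots> \<le> f ?r + n"
      using set_diamD[OF diam] that b by (intro add_mono) auto
    finally have "word_length G S (inv a \<otimes> x) \<le> nat \<lfloor>f ?r + n\<rfloor>"
      unfolding word_dist_def by (rule le_nat_floor)
    then show ?thesis
      using that b carrier unfolding B_def by blast
  qed
  have subset: "A \<subseteq> N A" if "A \<in> P" for A
    using carrier[OF that] word_dist_self by (force simp: N_def)
  have finB: "finite B" unfolding B_def by (rule finite_word_ball[OF assms(1)])
  have fin: "finite (N A)" if "A \<in> P" for A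
  proof -
    have "A \<noteq> {}" using that P by (auto simp: partition_on_def)
    then obtain a where a: "a \<in> A" "a \<in> carrier G"
      using carrier[OF \<open>A \<in> P\<close>] by blast
    \<comment> \<open>Seen from any one point of the piece, the neighbourhood sits in a left
      translate of the finite ball.\<close>
    have "N A \<subseteq> (\<lambda>b. a \<otimes> b) ` B"
    proof
      fix x assume "x \<in> N A"
      moreover from this have "a \<otimes> (inv a \<otimes> x) = x"
        using a by (simp add: N_def flip: m_assoc)
      ultimately show "x \<in> (\<lambda>b. a \<otimes> b) ` B"
        using displacement[OF that a(1)] by force
    qed
    then show ?thesis using finB finite_subset by blast
  qed
  have disj: "N A \<inter> N A' = {}" if "A \<in> P" "A' \<in> P" "A \<noteq> A'" "color A = color A'" for A A'
  proof (rule ccontr)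
    assume "N A \<inter> N A' \<noteq> {}"
    then obtain x a b where x: "x \<in> carrier G" "a \<in> A" "?\<delta> a x \<le> n" "b \<in> A'" "?\<delta> b x \<le> n"
      by (auto simp: N_def)
    have "?\<delta> a b \<le> ?\<delta> a x + ?\<delta> x b"
      using x that carrier by (intro word_dist_triangle) auto
    also have "?\<delta> x b = ?\<delta> b x"
      using x that carrier by (intro word_dist_commute) auto
    finally have "?\<delta> a b \<le> ?r" using x by simp
    moreover have "ereal ?r < set_dist ?\<delta> A A'"
    proof -
      have "color A \<in> {0..d}" using that(1) color by auto
      from r_disj[OF this] show ?thesis
        using that unfolding r_disjoint_def by simp
    qed
    ultimately show False using set_distD x by fastforce
  qed
  have fin_piece: "finite A" if "A \<in> P" for A
    using finite_subset[OF subset fin] that by blast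
  have "\<exists>A\<in>P. card (N A) \<le> (d + 1) * card A"
  proof (rule ex_small_neighbourhood[OF P color finB])
    show "B \<subseteq> carrier G" by (auto simp: B_def)
    show "N A \<subseteq> carrier G" for A by (auto simp: N_def)
  qed (fact fin_piece fin subset displacement disj)+
  then obtain A where A: "A \<in> P" "card (N A) \<le> (d + 1) * card A"
    by blast
  \<comment> \<open>Points outside \<open>N A\<close> are farther than \<open>n\<close> from every
    point of \<open>A\<close>. If \<open>N A\<close> is the whole group, the infimum over the empty
    set is infinite.\<close>
  have "ereal (real n) \<le> set_dist ?\<delta> A (carrier G - N A)"
    unfolding set_dist_def by (intro INF_greatest) (auto simp: N_def)
  moreover have "set_diam ?\<delta> (N A) \<le> ereal (f ?r + ?r)"
    unfolding set_diam_def
  proof (intro SUP_least)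
    fix x y assume "x \<in> N A" "y \<in> N A"
    then obtain a b where ab: "x \<in> carrier G" "y \<in> carrier G" "a \<in> A" "b \<in> A"
        "?\<delta> a x \<le> n" "?\<delta> b y \<le> n" by (auto simp: N_def)
    then have c: "a \<in> carrier G" "b \<in> carrier G" using carrier A by auto
    \<comment> \<open>Travel from \<open>x\<close> to \<open>a\<close>, across the piece to
      \<open>b\<close>, and on to \<open>y\<close>; the two outer legs account for the summand
      \<open>?r\<close>.\<close>
    show "ereal (?\<delta> x y) \<le> ereal (f ?r + ?r)"
      using word_dist_triangle[of x a y] word_dist_triangle[of a b y] word_dist_commute[of x a]
        set_diamD[OF diam[OF A(1)] ab(3,4)] ab c by simp
  qed
  moreover have "real (card (N A)) \<le> (real d + 1) * real (card A)"
    using of_nat_mono[OF A(2), where 'a = real] by (simp add: algebra_simps)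
  moreover have "N A \<subseteq> carrier G" by (auto simp: N_def)
  moreover have "A \<noteq> {}" using A P by (auto simp: partition_on_def)
  moreover from this have "N A \<noteq> {}" using subset[OF A(1)] by blast
  ultimately show ?thesis
    using subset[OF A(1)] fin[OF A(1)] fin_piece[OF A(1)] by (intro exI[of _ A] exI[of _ "N A"]) simp
qed

theorem theorem3p1:
  fixes G :: "('a, 'b) monoid_scheme" and S :: "'a set"
    and d :: nat and f :: "real \<Rightarrow> real"
  assumes "group G"
    and "finite S" and "S \<subseteq> carrier G"
    and "\<forall>s\<in>S. inv\<^bsub>G\<^esub> s \<in> S"
    and "generate G S = carrier G"
    and "amenable G"
    and "asdim_at_most_with_control (carrier G) (word_dist G S) d f"
  shows "\<exists>F' F. folner_couples G S (real d + 1) F' F \<and>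
           (\<forall>n\<ge>1. set_diam (word_dist G S) (F n) \<le> ereal (f (2 * real n) + 2 * real n))"
proof -
  interpret word_metric G S
    using assms by (simp add: word_metric_def word_metric_axioms_def)
  define couple where "couple n A E \<longleftrightarrow>
      finite A \<and> finite E \<and> A \<noteq> {} \<and> E \<noteq> {} \<and> A \<subseteq> E \<and> E \<subseteq> carrier G \<and>
      real (card E) \<le> (real d + 1) * real (card A) \<and>
      ereal (real n) \<le> set_dist (word_dist G S) A (carrier G - E) \<and>
      set_diam (word_dist G S) E \<le> ereal (f (2 * real n) + 2 * real n)" for n A E
  have "\<exists>A E. couple n A E" if "n \<ge> 1" for n
    unfolding couple_def using that by (rule ex_folner_couple[OF assms(2,6,7)])
  then obtain F' F where F: "\<And>n. n \<ge> 1 \<Longrightarrow> couple n (F' n) (F n)"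
    by metis
  show ?thesis
    by (intro exI[of _ F'] exI[of _ F]) (use F in \<open>simp add: couple_def folner_couples_def\<close>)
qed

end
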